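(* There exists an infinite sequence of integers $\ell_1 = 2 < \ell_2 < \ell_3 < \cdots$ such that for each $j \ge 1$ the floor quotient Möbius function has $$(-1)^j \mu_1(1,\ell_j) > 0,$$ with $\ell_j$ satisfying the bounds $$\ell_{j+1} \le 2\ell_j^2 - 2 .$$ Consequently the function $n \mapsto \mu_1(1,n)$ has infinitely many sign changes as $n$ varies.
   Context: $\mathbb{N}^+ = \{1,2,3,\ldots\}$. For positive integers $d,n$, $d$ is a floor quotient of $n$, written $d \preccurlyeq_1 n$, if $d = \lfloor n/k \rfloor$ for some positive integer $k$; this relation is a partial order on $\mathbb{N}^+$. The floor quotient Möbius function $\mu_1 : \mathbb{N}^+ \times \mathbb{N}^+ \to \mathbb{Z}$ is the unique function with $\mu_1(n,n)=1$ for all $n$, $\mu_1(d,n)=0$ if $d \not\preccurlyeq_1 n$, and $\sum_{m:\, d \preccurlyeq_1 m \preccurlyeq_1 n} \mu_1(d,m) = 0$ for all $d \ne n$. *)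

theory Defs
  imports Main
begin

text \<open>The positive integers are represented by the nonzero elements of \<^typ>\<open>nat\<close>; the relation
  and the Moebius function below are relevant on positive arguments only.\<close>

definition floor_quotient :: "nat \<Rightarrow> nat \<Rightarrow> bool" (infix "\<preceq>\<^sub>1" 50) where
  "d \<preceq>\<^sub>1 n \<longleftrightarrow> 0 < d \<and> 0 < n \<and> (\<exists>k>0. d = n div k)"

lemma floor_quotient_le: "d \<preceq>\<^sub>1 n \<Longrightarrow> d \<le> n"
  by (auto simp: floor_quotient_def)

lemma floor_quotient_refl: "0 < n \<Longrightarrow> n \<preceq>\<^sub>1 n"
  unfolding floor_quotient_def by (metis div_by_1 zero_less_one)

lemma floor_quotient_antisym: "d \<preceq>\<^sub>1 n \<Longrightarrow> n \<preceq>\<^sub>1 d \<Longrightarrow> d = n"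
  by (simp add: floor_quotient_le le_antisym)

lemma floor_quotient_trans: "d \<preceq>\<^sub>1 m \<Longrightarrow> m \<preceq>\<^sub>1 n \<Longrightarrow> d \<preceq>\<^sub>1 n"
  unfolding floor_quotient_def by (metis div_mult2_eq nat_0_less_mult_iff)

text \<open>The Moebius function is defined by solving its defining relation for the top term;
  \<open>fq_moebius_unique\<close> states that it is the unique function with the defining properties.\<close>

function fq_moebius :: "nat \<Rightarrow> nat \<Rightarrow> int" ("\<mu>\<^sub>1") where
  "\<mu>\<^sub>1 d n =
     (if d = n then 1
      else if d \<preceq>\<^sub>1 n then - (\<Sum>m \<in> {m. d \<preceq>\<^sub>1 m \<and> m \<preceq>\<^sub>1 n \<and> m \<noteq> n}. \<mu>\<^sub>1 d m)
      else 0)"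
  by auto
termination
  by (relation "measure snd") (auto dest: floor_quotient_le)

declare fq_moebius.simps [simp del]

definition is_fq_moebius :: "(nat \<Rightarrow> nat \<Rightarrow> int) \<Rightarrow> bool" where
  "is_fq_moebius f \<longleftrightarrow>
     (\<forall>n>0. f n n = 1) \<and>
     (\<forall>d>0. \<forall>n>0. \<not> d \<preceq>\<^sub>1 n \<longrightarrow> f d n = 0) \<and>
     (\<forall>d>0. \<forall>n>0. d \<noteq> n \<longrightarrow> (\<Sum>m \<in> {m. d \<preceq>\<^sub>1 m \<and> m \<preceq>\<^sub>1 n}. f d m) = 0)"

lemma finite_floor_quotients: "finite {m. P m \<and> m \<preceq>\<^sub>1 n \<and> Q m}"
  by (rule finite_subset[of _ "{..n}"]) (auto dest: floor_quotient_le)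

lemma floor_quotient_interval_sum:
  fixes f :: "nat \<Rightarrow> int"
  assumes "d \<preceq>\<^sub>1 n"
  shows "(\<Sum>m \<in> {m. d \<preceq>\<^sub>1 m \<and> m \<preceq>\<^sub>1 n}. f m)
       = f n + (\<Sum>m \<in> {m. d \<preceq>\<^sub>1 m \<and> m \<preceq>\<^sub>1 n \<and> m \<noteq> n}. f m)"
proof -
  have "n \<preceq>\<^sub>1 n"
    using assms floor_quotient_refl by (auto simp: floor_quotient_def)
  then have "{m. d \<preceq>\<^sub>1 m \<and> m \<preceq>\<^sub>1 n} = insert n {m. d \<preceq>\<^sub>1 m \<and> m \<preceq>\<^sub>1 n \<and> m \<noteq> n}"
    using assms by auto
  then show ?thesis
    using finite_floor_quotients[of "\<lambda>m. d \<preceq>\<^sub>1 m" n "\<lambda>m. m \<noteq> n"] by simp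
qed

lemma is_fq_moebius_fq_moebius: "is_fq_moebius \<mu>\<^sub>1"
  unfolding is_fq_moebius_def
proof (intro conjI allI impI)
  fix n :: nat show "\<mu>\<^sub>1 n n = 1" by (subst fq_moebius.simps) simp
next
  fix d n :: nat
  assume "0 < n" "\<not> d \<preceq>\<^sub>1 n"
  then show "\<mu>\<^sub>1 d n = 0"
    using floor_quotient_refl by (subst fq_moebius.simps) auto
next
  fix d n :: nat
  assume dn: "d \<noteq> n"
  show "(\<Sum>m \<in> {m. d \<preceq>\<^sub>1 m \<and> m \<preceq>\<^sub>1 n}. \<mu>\<^sub>1 d m) = 0"
  proof (cases "d \<preceq>\<^sub>1 n")
    case True
    then show ?thesis
      using dn by (simp add: floor_quotient_interval_sum fq_moebius.simps[of d n])
  next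
    case False
    then have "{m. d \<preceq>\<^sub>1 m \<and> m \<preceq>\<^sub>1 n} = {}"
      using floor_quotient_trans by blast
    then show ?thesis by (simp only: sum.empty)
  qed
qed

lemma fq_moebius_unique:
  assumes f: "is_fq_moebius f" and "0 < d" "0 < n"
  shows "f d n = \<mu>\<^sub>1 d n"
  using \<open>0 < n\<close>
proof (induction n rule: less_induct)
  case (less n)
  note g = is_fq_moebius_fq_moebius
  consider "d = n" | "\<not> d \<preceq>\<^sub>1 n" | "d \<noteq> n" "d \<preceq>\<^sub>1 n" by blast
  then show ?case
  proof cases
    case 3
    have "f d m = \<mu>\<^sub>1 d m" if "m \<in> {m. d \<preceq>\<^sub>1 m \<and> m \<preceq>\<^sub>1 n \<and> m \<noteq> n}" for m
      using that less.IH[of m] floor_quotient_le[of m n] by (auto simp: floor_quotient_def)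
    then have "(\<Sum>m \<in> {m. d \<preceq>\<^sub>1 m \<and> m \<preceq>\<^sub>1 n \<and> m \<noteq> n}. f d m)
             = (\<Sum>m \<in> {m. d \<preceq>\<^sub>1 m \<and> m \<preceq>\<^sub>1 n \<and> m \<noteq> n}. \<mu>\<^sub>1 d m)"
      by (rule sum.cong[OF refl])
    moreover have "(\<Sum>m \<in> {m. d \<preceq>\<^sub>1 m \<and> m \<preceq>\<^sub>1 n}. f d m) = 0"
      using f 3 \<open>0 < d\<close> less.prems unfolding is_fq_moebius_def by blast
    moreover have "(\<Sum>m \<in> {m. d \<preceq>\<^sub>1 m \<and> m \<preceq>\<^sub>1 n}. \<mu>\<^sub>1 d m) = 0"
      using g 3 \<open>0 < d\<close> less.prems unfolding is_fq_moebius_def by blast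
    ultimately show ?thesis
      by (simp add: floor_quotient_interval_sum[OF 3(2)])
  qed (use f g \<open>0 < d\<close> less.prems in \<open>auto simp: is_fq_moebius_def\<close>)
qed

text \<open>A sign change is a pair of positive indices at which \<open>a\<close> takes nonzero values of opposite
  sign, with only zero values strictly in between (zeros are skipped, as is usual).\<close>

definition sign_changes :: "(nat \<Rightarrow> int) \<Rightarrow> (nat \<times> nat) set" where
  "sign_changes a =
     {(m, n). 0 < m \<and> m < n \<and> a m * a n < 0 \<and> (\<forall>k. m < k \<and> k < n \<longrightarrow> a k = 0)}"

end

theory Submission
  imports Defs
begin

text \<open>Write \<open>M n = \<mu>\<^sub>1 1 n\<close>. For \<open>n > 1\<close> the values of \<open>M\<close> over all floor quotients of \<open>n\<close> sum to
  zero, and the floor quotients of \<open>n\<close> are among those of \<open>2 * n\<close>, because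
  \<open>n div k = (2 * n) div (2 * k)\<close>. Hence the values of \<open>M\<close> over the floor quotients that \<open>2 * n\<close>
  has and \<open>n\<close> lacks also sum to zero (\<open>sum_new_floor_quotients_of_double\<close>).

  The choice \<open>n = l\<^sup>2 - 1\<close> makes \<open>l\<close> the least element of this set of new floor quotients: every
  positive \<open>d < l\<close> is a floor quotient of \<open>l\<^sup>2 - 1\<close>, but \<open>l\<close> is skipped, since the factorization
  \<open>l\<^sup>2 - 1 = (l - 1) * (l + 1)\<close> makes the quotient drop from \<open>l + 1\<close> at \<open>k = l - 1\<close> directly to
  \<open>l - 1\<close> at \<open>k = l\<close>; and \<open>l\<close> reappears for \<open>2 * (l\<^sup>2 - 1)\<close> at \<open>k = 2 * l - 1\<close>.
  So if \<open>M l\<close> is nonzero, a later new floor quotient, necessarily at most \<open>2 * l\<^sup>2 - 2\<close>, carries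
  the opposite sign (\<open>opposite_sign_within_bound\<close>). Iterating this from \<open>M 2 = -1\<close> gives the
  sequence, and between two indices of opposite sign there is always a sign change.\<close>

section \<open>Floor quotients gained by doubling\<close>

lemma floor_quotient_double: "d \<preceq>\<^sub>1 n \<Longrightarrow> d \<preceq>\<^sub>1 2 * n"
proof -
  assume "d \<preceq>\<^sub>1 n"
  then obtain k where k: "0 < d" "0 < n" "k > 0" "d = n div k"
    by (auto simp: floor_quotient_def)
  then have "d = (2 * n) div (2 * k)" by simp
  with k show ?thesis
    unfolding floor_quotient_def by (intro conjI exI[of _ "2 * k"]) auto
qed

lemma one_floor_quotient: "0 < n \<Longrightarrow> 1 \<preceq>\<^sub>1 n"
  unfolding floor_quotient_def by (auto intro!: exI[of _ n])

lemma finite_floor_quotients_of: "finite {m. m \<preceq>\<^sub>1 n}"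
  using finite_floor_quotients[of "\<lambda>_. True" n "\<lambda>_. True"] by simp

lemma sum_moebius_floor_quotients:
  assumes "1 < n"
  shows "(\<Sum>m\<in>{m. m \<preceq>\<^sub>1 n}. \<mu>\<^sub>1 1 m) = 0"
proof -
  have "{m. m \<preceq>\<^sub>1 n} = {m. 1 \<preceq>\<^sub>1 m \<and> m \<preceq>\<^sub>1 n}"
    using one_floor_quotient by (auto simp: floor_quotient_def)
  then show ?thesis
    using is_fq_moebius_fq_moebius assms unfolding is_fq_moebius_def by simp
qed

lemma sum_new_floor_quotients_of_double:
  assumes "1 < n"
  shows "(\<Sum>m\<in>{m. m \<preceq>\<^sub>1 2 * n \<and> \<not> m \<preceq>\<^sub>1 n}. \<mu>\<^sub>1 1 m) = 0"
proof -
  have "{m. m \<preceq>\<^sub>1 2 * n \<and> \<not> m \<preceq>\<^sub>1 n} = {m. m \<preceq>\<^sub>1 2 * n} - {m. m \<preceq>\<^sub>1 n}"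
    by auto
  moreover have "{m. m \<preceq>\<^sub>1 n} \<subseteq> {m. m \<preceq>\<^sub>1 2 * n}"
    using floor_quotient_double by auto
  ultimately show ?thesis
    using sum_moebius_floor_quotients[of n] sum_moebius_floor_quotients[of "2 * n"] assms
    by (simp add: sum_diff finite_floor_quotients_of)
qed

section \<open>Floor quotients around the square root\<close>

text \<open>For \<open>d\<close> up to the square root of \<open>n\<close>, the largest \<open>k\<close> with \<open>k * d \<le> n\<close> satisfies
  \<open>k \<ge> d\<close>, and then \<open>n < (k + 1) * d \<le> k * (d + 1)\<close>.\<close>
lemma floor_quotient_if_square_le:
  assumes "0 < d" "d * d \<le> n"
  shows "d \<preceq>\<^sub>1 n"
proof -
  define k where "k = n div d"
  have "d \<le> k"
    using assms by (simp add: k_def less_eq_div_iff_mult_less_eq)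
  moreover have "k * d \<le> n" "n < Suc k * d"
    using assms dividend_less_div_times[of d n] by (simp_all add: k_def)
  ultimately have "n div k = d"
    by (intro div_nat_eqI) (auto simp: algebra_simps)
  moreover have "0 < n" "0 < k"
    using assms \<open>d \<le> k\<close> by (auto intro: gr0I)
  ultimately show ?thesis
    using assms unfolding floor_quotient_def by blast
qed

text \<open>A witness \<open>k\<close> would satisfy \<open>l * k < l * l\<close>, hence \<open>k \<le> l - 1\<close>; but then
  \<open>(l + 1) * k \<le> (l + 1) * (l - 1) = l * l - 1\<close>, so the quotient is at least \<open>l + 1\<close>.\<close>
lemma not_floor_quotient_square_minus_one: "\<not> l \<preceq>\<^sub>1 l * l - 1"
proof
  assume "l \<preceq>\<^sub>1 l * l - 1"
  then obtain k where k: "k > 0" "l = (l * l - 1) div k" "0 < l" "0 < l * l - 1"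
    by (auto simp: floor_quotient_def)
  have le: "l * k \<le> l * l - 1"
    by (subst (1) k(2)) (rule div_times_less_eq_dividend)
  have less: "l * l - 1 < l * k + k"
    using dividend_less_div_times[of k "l * l - 1"] k(1) unfolding k(2)[symmetric]
    by (simp add: add.commute)
  have "l * k < l * l" using le k(4) by linarith
  then have "Suc k \<le> l" by simp
  then obtain c where "l = Suc k + c" using le_Suc_ex by blast
  with less show False by (simp add: algebra_simps)
qed

lemma floor_quotient_double_square_minus_one:
  assumes "2 \<le> l"
  shows "l \<preceq>\<^sub>1 2 * (l * l - 1)"
proof -
  obtain c where c: "l = c + 2" using assms le_Suc_ex by (metis add.commute)
  have "(2 * (l * l - 1)) div (2 * l - 1) = l"
    by (intro div_nat_eqI) (auto simp: c algebra_simps)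
  with c show ?thesis
    unfolding floor_quotient_def by (intro conjI exI[of _ "2 * l - 1"]) auto
qed

section \<open>Signs of the Moebius function\<close>

lemma sum_zero_opposite_sign:
  fixes f :: "'a \<Rightarrow> int"
  assumes "finite S" "(\<Sum>x\<in>S. f x) = 0" "a \<in> S" "f a \<noteq> 0"
  shows "\<exists>b\<in>S. f a * f b < 0"
proof (rule ccontr)
  assume "\<not> ?thesis"
  then have "f a * f a \<le> (\<Sum>x\<in>S. f a * f x)"
    using assms by (intro member_le_sum) (auto simp: not_less)
  also have "\<dots> = 0"
    using assms by (simp flip: sum_distrib_left)
  finally show False
    using assms(4) by (auto simp: mult_le_0_iff)
qed

lemma opposite_sign_within_bound:
  assumes "2 \<le> l" "\<mu>\<^sub>1 1 l \<noteq> 0"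
  shows "\<exists>m. l < m \<and> m \<le> 2 * (l * l - 1) \<and> \<mu>\<^sub>1 1 l * \<mu>\<^sub>1 1 m < 0"
proof -
  define n where "n = l * l - 1"
  let ?S = "{m. m \<preceq>\<^sub>1 2 * n \<and> \<not> m \<preceq>\<^sub>1 n}"
  have "2 * 2 \<le> l * l" using assms(1) by (rule mult_le_mono) (rule assms(1))
  then have "1 < n" by (simp add: n_def)
  have "finite ?S"
    using finite_subset[OF _ finite_floor_quotients_of[of "2 * n"]] by auto
  moreover have "l \<in> ?S"
    using assms not_floor_quotient_square_minus_one floor_quotient_double_square_minus_one
    by (simp add: n_def)
  ultimately obtain m where m: "m \<in> ?S" "\<mu>\<^sub>1 1 l * \<mu>\<^sub>1 1 m < 0"
    using sum_zero_opposite_sign[of ?S "\<mu>\<^sub>1 1" l] assms(2)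
      sum_new_floor_quotients_of_double[OF \<open>1 < n\<close>] by auto
  have "\<not> m < l"
  proof
    assume "m < l"
    then have "m * m < l * l" by (simp add: mult_strict_mono)
    then have "m \<preceq>\<^sub>1 n"
      using m(1) floor_quotient_if_square_le[of m n] by (auto simp: n_def floor_quotient_def)
    with m(1) show False by simp
  qed
  moreover have "m \<noteq> l"
    using m(2) by (auto simp: mult_less_0_iff)
  ultimately show ?thesis
    using m floor_quotient_le[of m "2 * n"] by (intro exI[of _ m]) (auto simp: n_def)
qed

lemma moebius_1_2: "\<mu>\<^sub>1 1 2 = -1"
proof -
  have "{m. m \<preceq>\<^sub>1 2} = {1, 2}"
  proof
    show "{m. m \<preceq>\<^sub>1 2} \<subseteq> {1, 2}"
    proof
      fix m assume "m \<in> {m. m \<preceq>\<^sub>1 2}"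
      then have "0 < m" "m \<le> 2"
        using floor_quotient_le[of m 2] by (simp_all add: floor_quotient_def)
      then show "m \<in> {1, 2}" by auto
    qed
  qed (use one_floor_quotient[of 2] floor_quotient_refl[of 2] in auto)
  then have "\<mu>\<^sub>1 1 1 + \<mu>\<^sub>1 1 2 = 0"
    using sum_moebius_floor_quotients[of 2] by simp
  moreover have "\<mu>\<^sub>1 1 1 = 1" by (subst fq_moebius.simps) simp
  ultimately show ?thesis by simp
qed

lemma alternating_sequence:
  "\<exists>f. f 0 = 2 \<and> (\<forall>j. (-1) ^ Suc j * \<mu>\<^sub>1 1 (f j) > 0) \<and>
       (\<forall>j. f j < f (Suc j) \<and> f (Suc j) \<le> 2 * (f j * f j - 1))"
proof -
  (* Dependent choice does not prescribe the first term, so the clause for j = 0 pins it down. *)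
  let ?P = "\<lambda>j x. 2 \<le> x \<and> (-1) ^ Suc j * \<mu>\<^sub>1 1 x > 0 \<and> (j = 0 \<longrightarrow> x = 2)"
  have base: "\<exists>x. ?P 0 x"
    using moebius_1_2 by auto
  have step: "\<exists>y. ?P (Suc j) y \<and> (x < y \<and> y \<le> 2 * (x * x - 1))" if "?P j x" for j x
  proof -
    from that have "\<mu>\<^sub>1 1 x \<noteq> 0" by auto
    with that obtain y where y: "x < y" "y \<le> 2 * (x * x - 1)" "\<mu>\<^sub>1 1 x * \<mu>\<^sub>1 1 y < 0"
      using opposite_sign_within_bound[of x] by auto
    have "(-1) ^ Suc (Suc j) * \<mu>\<^sub>1 1 y > 0"
      using that y(3) by (cases "even j") (auto simp: mult_less_0_iff)
    with that y show ?thesis by (intro exI[of _ y]) auto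
  qed
  obtain f where f: "\<And>j. ?P j (f j)" "\<And>j. f j < f (Suc j) \<and> f (Suc j) \<le> 2 * (f j * f j - 1)"
    using dependent_nat_choice[of ?P "\<lambda>_ x y. x < y \<and> y \<le> 2 * (x * x - 1)", OF base step]
    by blast
  then show ?thesis
    by (intro exI[of _ f]) auto
qed

section \<open>Sign changes\<close>

text \<open>Take \<open>n\<close> to be the first index after \<open>p\<close> with sign opposite to \<open>a p\<close>, and \<open>m\<close> the last index
  before \<open>n\<close> with \<open>a m \<noteq> 0\<close>; then \<open>m\<close> still has the sign of \<open>a p\<close>.\<close>
lemma sign_change_between:
  fixes a :: "nat \<Rightarrow> int"
  assumes "0 < p" "p < q" "a p * a q < 0"
  shows "\<exists>m n. (m, n) \<in> sign_changes a \<and> p \<le> m"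
proof -
  define n where "n = (LEAST n. p < n \<and> a p * a n < 0)"
  have n: "p < n" "a p * a n < 0"
    using LeastI[of "\<lambda>n. p < n \<and> a p * a n < 0" q] assms by (auto simp: n_def)
  have before: "\<not> a p * a k < 0" if "p < k" "k < n" for k
    using not_less_Least[of k "\<lambda>n. p < n \<and> a p * a n < 0"] that by (auto simp: n_def)
  define S where "S = {k. p \<le> k \<and> k < n \<and> a k \<noteq> 0}"
  have S: "finite S" "p \<in> S"
    using n by (auto simp: S_def)
  define m where "m = Max S"
  have "m \<in> S" using S by (auto simp: m_def intro!: Max_in)
  then have m: "p \<le> m" "m < n" "a m \<noteq> 0" by (auto simp: S_def)
  have "a k = 0" if "m < k" "k < n" for k
  proof -
    have "k \<notin> S"
      using Max_ge[OF S(1), of k] that(1) by (auto simp flip: m_def)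
    with that m show ?thesis by (simp add: S_def)
  qed
  moreover have "a m * a n < 0"
  proof (cases "m = p")
    case False
    then have "\<not> a p * a m < 0" using m before by simp
    with n m show ?thesis by (auto simp: mult_less_0_iff)
  qed (use n in simp)
  ultimately show ?thesis
    using m assms(1) by (intro exI[of _ m] exI[of _ n]) (auto simp: sign_changes_def)
qed

lemma infinite_sign_changes_if_alternating:
  fixes a :: "nat \<Rightarrow> int" and f :: "nat \<Rightarrow> nat"
  assumes "strict_mono f" "\<And>j. a (f j) * a (f (Suc j)) < 0"
  shows "infinite (sign_changes a)"
proof
  assume fin: "finite (sign_changes a)"
  then obtain N where N: "\<And>m n. (m, n) \<in> sign_changes a \<Longrightarrow> m \<le> N"
    using finite_nat_set_iff_bounded_le[of "fst ` sign_changes a"] by force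
  have "Suc N \<le> f (Suc N)" "f (Suc N) < f (Suc (Suc N))"
    using assms(1) by (auto simp: strict_mono_imp_increasing strict_mono_less)
  then obtain m n where "(m, n) \<in> sign_changes a" "f (Suc N) \<le> m"
    using sign_change_between[of "f (Suc N)" "f (Suc (Suc N))" a] assms(2) by auto
  with N \<open>Suc N \<le> f (Suc N)\<close> show False by force
qed

theorem theorem1p6:
  shows "(\<exists>l :: nat \<Rightarrow> nat.
            l 1 = 2 \<and>
            strict_mono_on {1..} l \<and>
            (\<forall>j\<ge>1. (-1) ^ j * \<mu>\<^sub>1 1 (l j) > 0) \<and>
            (\<forall>j\<ge>1. int (l (j + 1)) \<le> 2 * (int (l j))\<^sup>2 - 2))
       \<and> infinite (sign_changes (\<lambda>n. \<mu>\<^sub>1 1 n))"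
proof -
  obtain f where f: "f 0 = 2" "\<And>j. (-1) ^ Suc j * \<mu>\<^sub>1 1 (f j) > 0"
    "\<And>j. f j < f (Suc j)" "\<And>j. f (Suc j) \<le> 2 * (f j * f j - 1)"
    using alternating_sequence by blast
  have mono: "strict_mono f" using f(3) by (simp add: strict_mono_Suc_iff)
  have bound: "int (f (Suc j)) \<le> 2 * (int (f j))\<^sup>2 - 2" for j
  proof -
    have "0 < f j" using f(1) f(3)[of "j - 1"] by (cases j) simp_all
    then have "1 \<le> f j * f j" by (simp add: Suc_le_eq)
    then have "int (f j * f j - 1) = (int (f j))\<^sup>2 - 1"
      by (simp add: of_nat_diff power2_eq_square)
    with f(4)[of j] show ?thesis by linarith
  qed
  (* The sequence in the statement starts at index 1, whereas f starts at 0. *)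
  define l where "l j = f (j - 1)" for j
  have "l 1 = 2" by (simp add: l_def f)
  moreover have "strict_mono_on {1..} l"
    using mono by (auto simp: l_def strict_mono_on_def strict_mono_less)
  moreover have "(-1) ^ j * \<mu>\<^sub>1 1 (l j) > 0" if "j \<ge> 1" for j
    using f(2)[of "j - 1"] that by (simp add: l_def)
  moreover have "int (l (j + 1)) \<le> 2 * (int (l j))\<^sup>2 - 2" if "j \<ge> 1" for j
    using bound[of "j - 1"] that by (simp add: l_def)
  moreover have "\<mu>\<^sub>1 1 (f j) * \<mu>\<^sub>1 1 (f (Suc j)) < 0" for j
    using f(2)[of j] f(2)[of "Suc j"] by (cases "even j") (auto simp: mult_less_0_iff)
  then have "infinite (sign_changes (\<lambda>n. \<mu>\<^sub>1 1 n))"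
    using infinite_sign_changes_if_alternating[OF mono] by blast
  ultimately show ?thesis by blast
qed

end
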